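(* Let $\alpha,\beta>-1$ be real, let $n\in\mathbb N=\{0,1,2,\ldots\}$, put $\sigma:=\alpha+\beta+1$ and $\mathbf D:=\frac{\mathrm d}{\mathrm dx}$, and let $D^n_i(x;\alpha,\beta)$ be the dual Bernstein polynomials of degree $n$. For every $i=0,1,\ldots,n$ the following identity of polynomials in $x$ holds: $$\Big(x(x-1)\mathbf D^2+\tfrac12\big(\alpha-\beta+(\sigma+1)(2x-1)\big)\mathbf D\Big)D^n_i(x;\alpha,\beta)$$ $$=(i-n)(i+\beta+1)D^n_{i+1}(x;\alpha,\beta)+i(i-\alpha-n-1)D^n_{i-1}(x;\alpha,\beta)-\big(i(i-\alpha-n-1)+(i-n)(i+\beta+1)\big)D^n_i(x;\alpha,\beta).$$
   Context: Inner product: $\langle f,g\rangle_{\alpha,\beta}:=\int_0^1(1-x)^\alpha x^\beta f(x)g(x)\,\mathrm dx$. Bernstein basis polynomials: $B^n_i(x):=\binom{n}{i}x^i(1-x)^{n-i}$, $i=0,\ldots,n$; they form a basis of the space $\Pi_n$ of polynomials of degree at most $n$. Dual Bernstein polynomials of degree $n$: the polynomials $D^n_0(x;\alpha,\beta),\ldots,D^n_n(x;\alpha,\beta)\in\Pi_n$ determined by $\langle B^n_i,D^n_j(\cdot;\alpha,\beta)\rangle_{\alpha,\beta}=\delta_{ij}$ for $i,j=0,\ldots,n$. Convention: $D^n_i(x;\alpha,\beta):=0$ for $i<0$ or $i>n$. *)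

theory Defs
  imports "HOL-Analysis.Analysis" "HOL-Computational_Algebra.Polynomial"
begin

(* At the endpoints HOL has 0 powr a = 0 for every a, so the integrand is total; this affects
   only a null set and hence not the value of the integral. *)
definition jacobi_inner :: "real \<Rightarrow> real \<Rightarrow> (real \<Rightarrow> real) \<Rightarrow> (real \<Rightarrow> real) \<Rightarrow> real" where
  "jacobi_inner \<alpha> \<beta> f g =
     integral {0..1} (\<lambda>x. (1 - x) powr \<alpha> * x powr \<beta> * f x * g x)"

(* The index is an integer so that the convention D = 0 outside 0..n also covers index -1.
   Existence and uniqueness of the described polynomial hold for \<alpha>, \<beta> > -1. *)
definition dual_bernstein :: "nat \<Rightarrow> real \<Rightarrow> real \<Rightarrow> int \<Rightarrow> real poly" where
  "dual_bernstein n \<alpha> \<beta> j =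
     (if 0 \<le> j \<and> j \<le> int n
      then (THE p. degree p \<le> n \<and>
              (\<forall>i\<le>n. jacobi_inner \<alpha> \<beta> (Bernstein n i) (poly p) = (if int i = j then 1 else 0)))
      else 0)"

end

theory Submission
  imports Defs
begin

text \<open>The operator is \<open>L f = - (x (1 - x) w f')' / w\<close> with the Jacobi weight
  \<open>w = (1 - x)\<^sup>\<alpha> x\<^sup>\<beta>\<close>, hence symmetric for the inner product. It maps the Bernstein polynomial
  \<open>B\<^sub>k\<close> to a combination of \<open>B\<^bsub>k-1\<^esub>\<close>, \<open>B\<^sub>k\<close>, \<open>B\<^bsub>k+1\<^esub>\<close>, so on the dual basis it acts by the
  transposed tridiagonal matrix, which is the asserted identity.\<close>

section \<open>Bernstein polynomials\<close>

lemma smult_sum_right: "smult c (sum f A) = (\<Sum>i\<in>A. smult c (f i))"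
  by (induction A rule: infinite_finite_induct) (simp_all add: smult_add_right)

text \<open>The library function \<open>Bernstein\<close> as a formal polynomial, so that
  \<open>pderiv\<close> and \<open>degree\<close> apply. For \<open>k > n\<close> the binomial
  coefficient vanishes, so the truncated exponent does no harm.\<close>

definition bernstein_poly :: "nat \<Rightarrow> nat \<Rightarrow> real poly" where
  "bernstein_poly n k = smult (real (n choose k)) ([:0, 1:] ^ k * [:1, -1:] ^ (n - k))"

lemma poly_bernstein_poly: "poly (bernstein_poly n k) x = Bernstein n k x"
  by (simp add: bernstein_poly_def Bernstein_def)

lemma degree_bernstein_poly_le:
  assumes "k \<le> n"
  shows "degree (bernstein_poly n k) \<le> n"
proof -
  have "degree ([:0, 1::real:] ^ k * [:1, -1:] ^ (n - k)) \<le> k + (n - k)"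
    by (intro order.trans[OF degree_mult_le] add_mono order.trans[OF degree_power_le]) auto
  with assms show ?thesis
    unfolding bernstein_poly_def by (intro order.trans[OF degree_smult_le]) simp
qed

lemma bernstein_poly_eq_0: "n < k \<Longrightarrow> bernstein_poly n k = 0"
  by (simp add: bernstein_poly_def)

text \<open>The factor \<open>k\<close> kills both sides at \<open>k = 0\<close>, the one case in
  which the truncated exponent \<open>k - 1\<close> is wrong.\<close>

lemma smult_mult_power_pred:
  fixes p q :: "real poly"
  shows "smult (real k) (p * (p ^ (k - 1) * q)) = smult (real k) (p ^ k * q)"
    and "smult (real k) (p * (q * p ^ (k - 1))) = smult (real k) (q * p ^ k)"
  by (cases k; simp add: ac_simps)+

lemma pderiv_X_power_Y_power:
  "pderiv ([:0, 1:] ^ k * [:1, -1:] ^ m :: real poly) =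
     smult (real k) ([:0, 1:] ^ (k - 1) * [:1, -1:] ^ m)
     - smult (real m) ([:0, 1:] ^ k * [:1, -1:] ^ (m - 1))"
  by (simp add: pderiv_mult pderiv_power pderiv_pCons algebra_simps)

lemma X_mult_pderiv_bernstein_poly:
  assumes "k \<le> n"
  shows "[:0, 1:] * pderiv (bernstein_poly n k) =
    smult (real k) (bernstein_poly n k) - smult (real k + 1) (bernstein_poly n (Suc k))"
proof -
  let ?X = "[:0, 1:] :: real poly" and ?Y = "[:1, -1:] :: real poly"
  \<comment> \<open>Both products equal n times the binomial coefficient of \<open>n - 1\<close>
    over \<open>k\<close>.\<close>
  have c: "real (n choose k) * real (n - k) = (real k + 1) * real (n choose Suc k)"
    using binomial_absorb_comp[of n k] binomial_absorption[of k n]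
    by (metis of_nat_Suc of_nat_mult mult.commute add.commute)
  have "?X * pderiv (bernstein_poly n k) =
     smult (real (n choose k)) (smult (real k) (?X * (?X ^ (k - 1) * ?Y ^ (n - k))))
      - smult (real (n choose k) * real (n - k)) (?X * ?X ^ k * ?Y ^ (n - k - 1))"
    unfolding bernstein_poly_def pderiv_smult pderiv_X_power_Y_power
    by (simp only: mult_smult_right right_diff_distrib smult_diff_right smult_smult mult.assoc)
  also have "\<dots> = smult (real k) (bernstein_poly n k) - smult (real k + 1) (bernstein_poly n (Suc k))"
    unfolding smult_mult_power_pred c by (simp add: bernstein_poly_def mult.commute del: mult_pCons_left)
  finally show ?thesis .
qed

text \<open>The counterpart for the factor 1 - x. The case \<open>k = 0\<close> is separated because
  the truncated index \<open>k - 1\<close> would otherwise contribute B_0 with coefficient n +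
  1.\<close>

lemma Y_mult_pderiv_bernstein_poly:
  assumes "k \<le> n"
  shows "[:1, -1:] * pderiv (bernstein_poly n k) =
    (if k = 0 then 0 else smult (real n - real k + 1) (bernstein_poly n (k - 1)))
      - smult (real n - real k) (bernstein_poly n k)"
proof -
  let ?X = "[:0, 1:] :: real poly" and ?Y = "[:1, -1:] :: real poly"
  have 1: "smult (real (n choose k)) (smult (real k) (?Y * (?X ^ (k - 1) * ?Y ^ (n - k)))) =
      (if k = 0 then 0 else smult (real n - real k + 1) (bernstein_poly n (k - 1)))"
  proof (cases k)
    case (Suc l)
    have "real (n choose k) * real k = (real n - real k + 1) * real (n choose l)"
      using binomial_absorb_comp[of n l] binomial_absorption[of l n] assms Suc
      by (metis (no_types, lifting) of_nat_mult mult.commute Suc_diff_le diff_Suc_Suc of_nat_Suc of_nat_diff add.commute)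
    moreover have "n - l = Suc (n - k)" using Suc assms by simp
    ultimately show ?thesis
      by (simp add: Suc bernstein_poly_def ac_simps del: mult_pCons_left mult_pCons_right of_nat_Suc binomial_Suc_Suc)
  qed simp
  have "?Y * pderiv (bernstein_poly n k) =
     smult (real (n choose k)) (smult (real k) (?Y * (?X ^ (k - 1) * ?Y ^ (n - k))))
      - smult (real (n choose k)) (smult (real (n - k)) (?Y * (?X ^ k * ?Y ^ (n - k - 1))))"
    unfolding bernstein_poly_def pderiv_smult pderiv_X_power_Y_power
    by (simp only: mult_smult_right right_diff_distrib smult_diff_right)
  also have "\<dots> = (if k = 0 then 0 else smult (real n - real k + 1) (bernstein_poly n (k - 1)))
      - smult (real n - real k) (bernstein_poly n k)"
    unfolding 1 smult_mult_power_pred using assms by (simp add: bernstein_poly_def mult.commute of_nat_diff)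
  finally show ?thesis .
qed

text \<open>The logarithmic derivative of B_k is k/x - (n-k)/(1-x), and multiplication by x(1-x)
  leaves k - nx. Differentiating this identity once more later yields the second-order term of the
  operator.\<close>

lemma X_Y_mult_pderiv_bernstein_poly:
  assumes "k \<le> n"
  shows "[:0, 1:] * [:1, -1:] * pderiv (bernstein_poly n k) =
    [:real k, - real n:] * bernstein_poly n k"
proof -
  let ?X = "[:0, 1:] :: real poly" and ?Y = "[:1, -1:] :: real poly"
  have "?X * ?Y * pderiv (?X ^ k * ?Y ^ (n - k)) =
     ?Y * smult (real k) (?X * (?X ^ (k - 1) * ?Y ^ (n - k)))
      - ?X * smult (real (n - k)) (?Y * (?X ^ k * ?Y ^ (n - k - 1)))"
    unfolding pderiv_X_power_Y_power
    by (simp only: mult_smult_right right_diff_distrib ac_simps)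
  also have "\<dots> = (smult (real k) ?Y - smult (real (n - k)) ?X) * (?X ^ k * ?Y ^ (n - k))"
    unfolding smult_mult_power_pred by (simp only: mult_smult_right mult_smult_left left_diff_distrib)
  also have "smult (real k) ?Y - smult (real (n - k)) ?X = [:real k, - real n:]"
    using assms by (simp add: of_nat_diff)
  finally show ?thesis
    by (simp only: bernstein_poly_def pderiv_smult mult_smult_right)
qed

text \<open>Multiply by the (n-k)-th power of x + (1-x) = 1 and expand binomially. This gives the
  spanning property used for uniqueness.\<close>

lemma monom_eq_sum_bernstein_poly:
  assumes "k \<le> n"
  shows "\<exists>c. [:0, 1:] ^ k = (\<Sum>i\<le>n. smult (c i) (bernstein_poly n i))"
proof -
  let ?X = "[:0, 1:] :: real poly" and ?Y = "[:1, -1:] :: real poly"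
  define c where "c i = (if i < k then 0 else real ((n - k) choose (i - k)) / real (n choose i))" for i
  have XY: "?X + ?Y = 1" by (simp add: one_pCons)
  have of_nat: "of_nat m * p = smult (real m) p" for m and p :: "real poly"
    by (simp add: of_nat_poly)
  have "?X ^ k = ?X ^ k * (?X + ?Y) ^ (n - k)"
    by (simp only: XY power_one mult_1_right)
  also have "\<dots> = (\<Sum>j\<le>n - k. smult (real ((n - k) choose j)) (?X ^ (k + j) * ?Y ^ (n - k - j)))"
    unfolding binomial_ring sum_distrib_left
    by (simp only: of_nat power_add mult.assoc mult_smult_left mult_smult_right)
  also have "\<dots> = (\<Sum>i\<in>{k..n}. smult (real ((n - k) choose (i - k))) (?X ^ i * ?Y ^ (n - i)))"
    by (rule sum.reindex_bij_witness[of _ "\<lambda>i. i - k" "\<lambda>j. k + j"]) (use assms in auto)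
  also have "\<dots> = (\<Sum>i\<in>{k..n}. smult (c i) (bernstein_poly n i))"
    by (intro sum.cong refl) (simp add: c_def bernstein_poly_def)
  also have "\<dots> = (\<Sum>i\<le>n. smult (c i) (bernstein_poly n i))"
    by (rule sum.mono_neutral_left) (auto simp: c_def)
  finally show ?thesis by blast
qed

text \<open>A vanishing combination makes \<open>q\<close> vanish at every positive real, hence
  \<open>q = 0\<close>; its coefficients are those of the combination up to nonzero binomial
  factors.\<close>

lemma bernstein_poly_independent:
  assumes "(\<Sum>i\<le>n. smult (c i) (bernstein_poly n i)) = 0" and "j \<le> n"
  shows "c j = 0"
proof -
  define q where "q = (\<Sum>i\<le>n. monom (c i * real (n choose i)) i)"
  have "poly q t = 0" if t: "t > 0" for t
  proof -
    \<comment> \<open>At \<open>x = t / (1 + t)\<close> one has \<open>x\<^sup>i (1 - x)\<^bsup>n-i\<^esup> = t\<^sup>i / (1 + t)\<^sup>n\<close>.\<close>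
    define x where "x = t / (1 + t)"
    have y: "1 - x = 1 / (1 + t)" using t by (simp add: x_def field_simps)
    have e: "x ^ i * (1 - x) ^ (n - i) = t ^ i / (1 + t) ^ n" if "i \<le> n" for i
      unfolding y using that t by (simp add: x_def power_divide flip: power_add)
    have "0 = poly (\<Sum>i\<le>n. smult (c i) (bernstein_poly n i)) x"
      using assms(1) by simp
    also have "\<dots> = (\<Sum>i\<le>n. c i * real (n choose i) * (x ^ i * (1 - x) ^ (n - i)))"
      by (simp add: poly_sum bernstein_poly_def ac_simps)
    also have "\<dots> = (\<Sum>i\<le>n. c i * real (n choose i) * (t ^ i / (1 + t) ^ n))"
      by (intro sum.cong refl) (use e in auto)
    also have "\<dots> = poly q t / (1 + t) ^ n"
      by (simp add: q_def poly_sum poly_monom sum_divide_distrib)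
    finally show ?thesis using t by (simp add: add_nonneg_eq_0_iff)
  qed
  then have "{0<..} \<subseteq> {t. poly q t = 0}" by auto
  then have "infinite {t. poly q t = 0}"
    using infinite_Ioi finite_subset by blast
  then have "q = 0" using poly_roots_finite by blast
  then have "coeff q j = 0" by simp
  moreover have "coeff q j = c j * real (n choose j)"
    using assms(2) by (simp add: q_def coeff_sum if_distrib sum.delta cong: if_cong)
  ultimately show ?thesis using assms(2) by simp
qed

section \<open>Integration against the Jacobi weight\<close>

locale jacobi_weight =
  fixes \<alpha> \<beta> :: real
  assumes \<alpha>: "\<alpha> > -1" and \<beta>: "\<beta> > -1"
begin

definition weight :: "real \<Rightarrow> real" where
  "weight x = (1 - x) powr \<alpha> * x powr \<beta>"

text \<open>The inner product depends only on the product of its arguments, so a linear functional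
  of one polynomial suffices.\<close>

definition wint :: "real poly \<Rightarrow> real" where
  "wint p = integral {0..1} (\<lambda>x. weight x * poly p x)"

lemma jacobi_inner_bernstein:
  "jacobi_inner \<alpha> \<beta> (Bernstein n i) (poly p) = wint (bernstein_poly n i * p)"
  by (simp add: jacobi_inner_def wint_def weight_def poly_bernstein_poly mult.assoc)

text \<open>This is an Euler Beta integrand with parameters \<beta> + k + 1 and \<alpha> + 1, both
  positive.\<close>

lemma weight_monom_integrable: "(\<lambda>x. weight x * x ^ k) integrable_on {0..1}"
proof -
  have "(\<lambda>x. x powr (\<beta> + k + 1 - 1) * (1 - x) powr (\<alpha> + 1 - 1)) integrable_on {0..1}"
    using has_integral_Beta_real[of "\<beta> + k + 1" "\<alpha> + 1"] \<alpha> \<beta> by (auto simp: integrable_on_def)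
  then show ?thesis
    by (rule integrable_eq) (auto simp: weight_def powr_add powr_realpow' power_0_left powr_realpow
        le_less)
qed

lemma weight_poly_integrable: "(\<lambda>x. weight x * poly p x) integrable_on {0..1}"
proof -
  have "(\<lambda>x. \<Sum>i\<le>degree p. coeff p i * (weight x * x ^ i)) integrable_on {0..1}"
    using integrable_cmul[OF weight_monom_integrable] by (intro integrable_sum) auto
  then show ?thesis
    by (simp add: poly_altdef sum_distrib_left ac_simps)
qed

lemma wint_add: "wint (p + q) = wint p + wint q"
  unfolding wint_def
  using integral_add[OF weight_poly_integrable[of p] weight_poly_integrable[of q]]
  by (simp add: distrib_left)

lemma wint_smult: "wint (smult c p) = c * wint p"
  by (simp add: wint_def mult.left_commute)

lemma wint_0 [simp]: "wint 0 = 0"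
  by (simp add: wint_def)

lemma wint_diff: "wint (p - q) = wint p - wint q"
  using wint_add[of p "smult (-1) q"] wint_smult[of "-1" q] by simp

lemma wint_sum: "wint (sum f A) = (\<Sum>i\<in>A. wint (f i))"
  by (induction A rule: infinite_finite_induct) (simp_all add: wint_add)

lemma wint_square_eq_0_iff: "wint (p * p) = 0 \<longleftrightarrow> p = 0"
proof
  assume 0: "wint (p * p) = 0"
  \<comment> \<open>The weight may be unbounded at the end points, so pass to a compact subinterval.\<close>
  let ?f = "\<lambda>x. weight x * poly (p * p) x"
  have cont: "continuous_on {1/4..3/4} ?f"
    unfolding weight_def by (auto intro!: continuous_intros)
  have nn: "?f x \<ge> 0" for x by (simp add: weight_def)
  have "integral {1/4..3/4} ?f \<le> integral {0..1} ?f"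
    using nn by (intro integral_subset_le weight_poly_integrable integrable_continuous_interval cont)
      (auto simp del: poly_mult)
  moreover have "integral {1/4..3/4} ?f \<ge> 0"
    by (intro integral_nonneg integrable_continuous_interval cont nn)
  ultimately have "integral {1/4..3/4} ?f = 0" using 0 by (simp add: wint_def)
  then have "\<forall>x\<in>{1/4..3/4}. ?f x = 0"
    using integral_eq_0_iff[OF cont] nn by auto
  then have "{1/4..3/4} \<subseteq> {x. poly p x = 0}"
    by (auto simp: weight_def)
  then have "infinite {x. poly p x = 0}"
    by (rule infinite_super) (simp add: infinite_Icc)
  then show "p = 0" using poly_roots_finite by blast
qed simp

text \<open>Times the weight w, the integrand is the derivative of x(1-x) w q. That function
  vanishes at both end points because \<alpha> + 1 and \<beta> + 1 are positive.\<close>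

lemma wint_total_derivative:
  "wint ([:\<beta> + 1, - (\<alpha> + \<beta> + 2):] * q + [:0, 1:] * [:1, -1:] * pderiv q) = 0"
proof -
  let ?F = "\<lambda>x. (1 - x) powr (\<alpha> + 1) * x powr (\<beta> + 1) * poly q x"
  let ?p = "[:\<beta> + 1, - (\<alpha> + \<beta> + 2):] * q + [:0, 1:] * [:1, -1:] * pderiv q"
  have cont: "continuous_on {0..1} ?F"
    using \<alpha> \<beta> by (auto intro!: continuous_intros continuous_on_powr')
  have deriv: "(?F has_vector_derivative weight x * poly ?p x) (at x)" if "x \<in> {0<..<1}" for x
  proof -
    have a: "(1 - x) powr (\<alpha> + 1) = (1 - x) powr \<alpha> * (1 - x)"
      and b: "x powr (\<beta> + 1) = x powr \<beta> * x"
      using that by (simp_all add: powr_add)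
    have "(?F has_real_derivative
       (((- ((\<alpha> + 1) * (1 - x) powr \<alpha>)) * x powr (\<beta> + 1)
         + (1 - x) powr (\<alpha> + 1) * ((\<beta> + 1) * x powr \<beta>)) * poly q x
       + (1 - x) powr (\<alpha> + 1) * x powr (\<beta> + 1) * poly (pderiv q) x)) (at x)"
      using that by (auto intro!: derivative_eq_intros)
    also have "((- ((\<alpha> + 1) * (1 - x) powr \<alpha>)) * x powr (\<beta> + 1)
         + (1 - x) powr (\<alpha> + 1) * ((\<beta> + 1) * x powr \<beta>)) * poly q x
       + (1 - x) powr (\<alpha> + 1) * x powr (\<beta> + 1) * poly (pderiv q) x = weight x * poly ?p x"
      unfolding a b weight_def by (simp add: algebra_simps)
    finally show ?thesis by (simp add: has_real_derivative_iff_has_vector_derivative)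
  qed
  \<comment> \<open>Differentiability is required only in the open interval, since the derivative
    may blow up at the end points.\<close>
  have "((\<lambda>x. weight x * poly ?p x) has_integral (?F 1 - ?F 0)) {0..1}"
    by (intro fundamental_theorem_of_calculus_interior cont deriv) auto
  then show ?thesis
    unfolding wint_def by (intro integral_unique) simp
qed

section \<open>The differential operator: symmetry, degree, and action on Bernstein
  polynomials\<close>

definition jacobi_op :: "real poly \<Rightarrow> real poly" where
  "jacobi_op p = [:0, 1:] * [:-1, 1:] * pderiv (pderiv p)
     + [:- (\<beta> + 1), \<alpha> + \<beta> + 2:] * pderiv p"

text \<open>Lagrange's identity: the two integrands differ by a total derivative, formed with the
  Wronskian \<open>?q\<close> of \<open>f\<close> and \<open>g\<close>.\<close>

lemma jacobi_op_symmetric: "wint (f * jacobi_op g) = wint (jacobi_op f * g)"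
proof -
  let ?q = "f * pderiv g - g * pderiv f"
  have "jacobi_op f * g - f * jacobi_op g =
    [:\<beta> + 1, - (\<alpha> + \<beta> + 2):] * ?q + [:0, 1:] * [:1, -1:] * pderiv ?q"
  proof -
    have 1: "[:-1, 1:] = - [:1, -1 :: real:]"
      and 2: "[:- (\<beta> + 1), \<alpha> + \<beta> + 2:] = - [:\<beta> + 1, - (\<alpha> + \<beta> + 2):]" by simp_all
    show ?thesis
      unfolding jacobi_op_def pderiv_diff pderiv_mult 1 2
      by (simp only: algebra_simps)
  qed
  then have "wint (jacobi_op f * g - f * jacobi_op g) = 0"
    using wint_total_derivative[of ?q] by simp
  then show ?thesis by (simp add: wint_diff)
qed

text \<open>Keeps the image of a dual polynomial in the space where pairings with the B_k determine
  it. Degrees 0 and 1 are treated apart because there the degree count by truncated subtraction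
  fails, while the derivative in question is zero.\<close>

lemma degree_jacobi_op_le:
  assumes "degree p \<le> n"
  shows "degree (jacobi_op p) \<le> n"
proof (cases "degree p = 0")
  case True
  then show ?thesis by (auto simp: jacobi_op_def pderiv_eq_0_iff[symmetric])
next
  case False
  have "degree [:- (\<beta> + 1), \<alpha> + \<beta> + 2:] \<le> 1" by simp
  with False assms have 1: "degree ([:- (\<beta> + 1), \<alpha> + \<beta> + 2:] * pderiv p) \<le> n"
    by (intro order.trans[OF degree_mult_le]) (unfold degree_pderiv, linarith)
  have 2: "degree ([:0, 1:] * [:-1, 1:] * pderiv (pderiv p)) \<le> n"
  proof (cases "degree p = 1")
    case True
    then have "pderiv (pderiv p) = 0"
      by (subst pderiv_eq_0_iff) (simp add: degree_pderiv)
    then show ?thesis by simp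
  next
    case False': False
    have "degree ([:0, 1:] * [:-1, 1::real:]) \<le> 2" by simp
    with False False' assms show ?thesis
      by (intro order.trans[OF degree_mult_le]) (auto simp: degree_pderiv)
  qed
  show ?thesis unfolding jacobi_op_def by (intro degree_add_le 1 2)
qed

text \<open>Differentiating \<open>X_Y_mult_pderiv_bernstein_poly\<close> eliminates the second
  derivative. What remains is n B_k plus a linear polynomial times the first derivative, covered by
  the formulas for the factors x and 1 - x.\<close>

lemma jacobi_op_bernstein_poly:
  assumes "k \<le> n"
  shows "jacobi_op (bernstein_poly n k) =
    smult ((real k + 1) * (real k - \<alpha> - real n)) (bernstein_poly n (Suc k))
    + (if k = 0 then 0
       else smult ((real k - 1 - real n) * (real k + \<beta>)) (bernstein_poly n (k - 1)))
    - smult (real k * (real k - \<alpha> - real n - 1) + (real k - real n) * (real k + \<beta> + 1))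
        (bernstein_poly n k)"
proof -
  let ?b = "bernstein_poly n k"
  let ?X = "[:0, 1:] :: real poly" and ?Y = "[:1, -1:] :: real poly"
  have "pderiv (?X * ?Y * pderiv ?b) = pderiv ([:real k, - real n:] * ?b)"
    using X_Y_mult_pderiv_bernstein_poly[OF assms] by simp
  then have "[:1, -2:] * pderiv ?b + ?X * ?Y * pderiv (pderiv ?b)
      = [:- real n:] * ?b + [:real k, - real n:] * pderiv ?b"
    unfolding pderiv_mult by (simp add: pderiv_pCons algebra_simps)
  then have s: "?X * ?Y * pderiv (pderiv ?b) =
      [:- real n:] * ?b + [:real k, - real n:] * pderiv ?b - [:1, -2:] * pderiv ?b"
    by (simp only: eq_diff_eq add.commute)
  have neg: "[:- real n:] = - [:real n:]" by simp
  have "jacobi_op ?b = [:- (\<beta> + 1), \<alpha> + \<beta> + 2:] * pderiv ?b - ?X * ?Y * pderiv (pderiv ?b)"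
    unfolding jacobi_op_def by simp
  also have "\<dots> = [:real n:] * ?b
      + ([:- (\<beta> + 1), \<alpha> + \<beta> + 2:] - [:real k, - real n:] + [:1, -2:]) * pderiv ?b"
    unfolding s neg by (simp only: algebra_simps mult_minus_left minus_minus)
  \<comment> \<open>A linear polynomial is its value at 1 times x plus its value at 0 times 1 -
    x.\<close>
  also have "[:- (\<beta> + 1), \<alpha> + \<beta> + 2:] - [:real k, - real n:] + [:1, -2:] =
      smult (real n + \<alpha> - real k) ?X - smult (real k + \<beta>) ?Y"
    by simp
  also have "[:real n:] * ?b + (\<dots>) * pderiv ?b = smult (real n) ?b
      + smult (real n + \<alpha> - real k) (?X * pderiv ?b) - smult (real k + \<beta>) (?Y * pderiv ?b)"
    by (simp only: left_diff_distrib mult_smult_left add_diff_eq) simp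
  also have "\<dots> = smult ((real k + 1) * (real k - \<alpha> - real n)) (bernstein_poly n (Suc k))
    + (if k = 0 then 0
       else smult ((real k - 1 - real n) * (real k + \<beta>)) (bernstein_poly n (k - 1)))
    - smult (real k * (real k - \<alpha> - real n - 1) + (real k - real n) * (real k + \<beta> + 1)) ?b"
    unfolding X_mult_pderiv_bernstein_poly[OF assms] Y_mult_pderiv_bernstein_poly[OF assms]
    by (rule poly_eqI) (simp add: algebra_simps)
  finally show ?thesis .
qed

section \<open>Existence and uniqueness of the dual basis\<close>

text \<open>One Gram-Schmidt step per element. The statement is general in \<open>f\<close> so that
  the induction hypothesis projects both \<open>f\<close> and the new vector
  \<open>v a\<close>.\<close>

lemma exists_orthogonal_projection:
  assumes "finite A"
  shows "\<exists>c. \<forall>i\<in>A. wint ((f - (\<Sum>j\<in>A. smult (c j) (v j))) * v i) = 0"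
  using assms
proof (induction A arbitrary: f rule: finite_induct)
  case (insert a A)
  obtain d where d: "\<And>i. i \<in> A \<Longrightarrow> wint ((v a - (\<Sum>j\<in>A. smult (d j) (v j))) * v i) = 0"
    using insert.IH[of "v a"] by blast
  obtain c where c: "\<And>i. i \<in> A \<Longrightarrow> wint ((f - (\<Sum>j\<in>A. smult (c j) (v j))) * v i) = 0"
    using insert.IH[of f] by blast
  define a' where "a' = v a - (\<Sum>j\<in>A. smult (d j) (v j))"
  define r where "r = f - (\<Sum>j\<in>A. smult (c j) (v j))"
  \<comment> \<open>The Fourier coefficient of \<open>r\<close> along the new orthogonal direction.
    If \<open>v a\<close> depends on the earlier vectors, then \<open>a' = 0\<close> and
    \<open>e\<close> is 0 by the convention for division by zero.\<close>
  define e where "e = wint (r * a') / wint (a' * a')"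
  define c' where "c' = (\<lambda>j. if j = a then e else c j - e * d j)"
  have "(\<Sum>j\<in>insert a A. smult (c' j) (v j)) =
      smult e (v a) + (\<Sum>j\<in>A. smult (c j - e * d j) (v j))"
    using insert.hyps by (simp add: c'_def) (intro sum.cong, auto)
  also have "\<dots> = (\<Sum>j\<in>A. smult (c j) (v j)) + smult e a'"
    by (simp add: a'_def smult_diff_left smult_diff_right sum_subtractf smult_sum_right flip: smult_smult)
  finally have r': "f - (\<Sum>j\<in>insert a A. smult (c' j) (v j)) = r - smult e a'"
    by (simp add: r_def)
  have A: "wint ((r - smult e a') * v i) = 0" if "i \<in> A" for i
    using c[OF that] d[OF that]
    by (simp add: left_diff_distrib wint_diff wint_smult flip: r_def a'_def)
  have "wint ((r - smult e a') * a') = 0"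
  proof (cases "a' = 0")
    case False
    then have "wint (a' * a') \<noteq> 0" by (simp add: wint_square_eq_0_iff)
    then show ?thesis by (simp add: left_diff_distrib wint_diff wint_smult e_def)
  qed simp
  moreover have "v a = a' + (\<Sum>j\<in>A. smult (d j) (v j))" by (simp add: a'_def)
  moreover have "wint ((r - smult e a') * (\<Sum>j\<in>A. smult (d j) (v j))) = 0"
    by (simp add: sum_distrib_left wint_sum wint_smult A)
  ultimately have "wint ((r - smult e a') * v a) = 0"
    by (simp only: distrib_left wint_add)
  with A show ?case
    unfolding r'[symmetric] by blast
qed simp

text \<open>The residual \<open>r\<close> of projecting B_j onto the other B_k is orthogonal to all
  of them. It is nonzero by independence, and its pairing with B_j equals its pairing with itself,
  so rescaling it suffices.\<close>

lemma exists_dual_bernstein: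
  assumes "j \<le> n"
  shows "\<exists>p. degree p \<le> n \<and>
    (\<forall>i\<le>n. wint (bernstein_poly n i * p) = (if i = j then 1 else 0))"
proof -
  let ?b = "bernstein_poly n" and ?A = "{..n} - {j}"
  obtain c where c: "\<And>i. i \<in> ?A \<Longrightarrow> wint ((?b j - (\<Sum>k\<in>?A. smult (c k) (?b k))) * ?b i) = 0"
    using exists_orthogonal_projection[of ?A "?b j" ?b] by auto
  define r where "r = ?b j - (\<Sum>k\<in>?A. smult (c k) (?b k))"
  have "r \<noteq> 0"
  proof
    assume "r = 0"
    define d where "d = (\<lambda>k. if k = j then 1 else - c k)"
    have "(\<Sum>k\<le>n. smult (d k) (?b k)) = smult (d j) (?b j) + (\<Sum>k\<in>?A. smult (d k) (?b k))"
      using assms by (intro sum.remove) auto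
    also have "(\<Sum>k\<in>?A. smult (d k) (?b k)) = - (\<Sum>k\<in>?A. smult (c k) (?b k))"
      unfolding sum_negf[symmetric] by (intro sum.cong) (auto simp: d_def)
    finally have "(\<Sum>k\<le>n. smult (d k) (?b k)) = r" by (simp add: d_def r_def)
    with \<open>r = 0\<close> have "d j = 0" using bernstein_poly_independent assms by blast
    then show False by (simp add: d_def)
  qed
  then have rr: "wint (r * r) \<noteq> 0" by (simp add: wint_square_eq_0_iff)
  have orth: "wint (?b i * r) = 0" if "i \<in> ?A" for i
    using c[OF that] by (simp add: r_def mult.commute)
  have "wint (r * r) = wint (?b j * r) - (\<Sum>k\<in>?A. c k * wint (?b k * r))"
    by (subst (1) r_def) (simp add: left_diff_distrib wint_diff sum_distrib_right wint_sum wint_smult)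
  also have "\<dots> = wint (?b j * r)" using orth by simp
  finally have j: "wint (?b j * r) = wint (r * r)" ..
  have "degree r \<le> n"
    unfolding r_def using assms
    by (intro degree_diff_le degree_sum_le order.trans[OF degree_smult_le]
        degree_bernstein_poly_le) auto
  then show ?thesis
    using rr j orth by (intro exI[of _ "smult (1 / wint (r * r)) r"]) (auto simp: wint_smult)
qed

text \<open>Through its monomials \<open>p\<close> is a combination of the B_i, hence orthogonal to
  itself.\<close>

lemma eq_0_if_orthogonal_bernstein_poly:
  assumes "degree p \<le> n" and "\<And>i. i \<le> n \<Longrightarrow> wint (bernstein_poly n i * p) = 0"
  shows "p = 0"
proof -
  have X: "wint ([:0, 1:] ^ k * p) = 0" if k: "k \<le> n" for k
  proof -
    obtain c where "[:0, 1:] ^ k = (\<Sum>i\<le>n. smult (c i) (bernstein_poly n i))"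
      using monom_eq_sum_bernstein_poly[OF k] by blast
    then show ?thesis
      by (simp add: sum_distrib_right wint_sum wint_smult assms(2))
  qed
  have "p = (\<Sum>k\<le>degree p. smult (coeff p k) ([:0, 1:] ^ k))"
    by (simp add: poly_as_sum_of_monoms flip: monom_altdef)
  then have "wint (p * p) = wint ((\<Sum>k\<le>degree p. smult (coeff p k) ([:0, 1:] ^ k)) * p)"
    by simp
  also have "\<dots> = 0"
    using X assms(1) by (simp add: sum_distrib_right wint_sum wint_smult)
  finally show ?thesis by (simp add: wint_square_eq_0_iff)
qed

text \<open>Existence and uniqueness make the \<open>THE\<close> in the definition meaningful.
  Indices \<open>j\<close> outside 0..n are included: the polynomial is then 0 and
  \<open>int i = j\<close> cannot hold.\<close>

lemma dual_bernstein_properties: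
  shows degree_dual_bernstein_le: "degree (dual_bernstein n \<alpha> \<beta> j) \<le> n"
    and wint_dual_bernstein:
      "i \<le> n \<Longrightarrow> wint (bernstein_poly n i * dual_bernstein n \<alpha> \<beta> j) = (if int i = j then 1 else 0)"
proof -
  have "degree (dual_bernstein n \<alpha> \<beta> j) \<le> n \<and>
    (\<forall>i\<le>n. wint (bernstein_poly n i * dual_bernstein n \<alpha> \<beta> j) = (if int i = j then 1 else 0))"
  proof (cases "0 \<le> j \<and> j \<le> int n")
    case True
    then obtain m where m: "j = int m" "m \<le> n" by (metis nonneg_int_cases of_nat_le_iff)
    define P where "P p \<longleftrightarrow> degree p \<le> n \<and>
      (\<forall>i\<le>n. wint (bernstein_poly n i * p) = (if int i = j then 1 else 0))" for p
    have "\<exists>p. P p"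
      using exists_dual_bernstein[OF m(2)] by (simp add: P_def m(1))
    moreover have "p = q" if "P p" "P q" for p q
    proof -
      have "p - q = 0"
        using that unfolding P_def
        by (intro eq_0_if_orthogonal_bernstein_poly[of _ n] degree_diff_le)
          (auto simp: right_diff_distrib wint_diff)
      then show ?thesis by simp
    qed
    ultimately have "P (THE p. P p)" by (metis theI)
    then show ?thesis
      using True by (simp add: dual_bernstein_def jacobi_inner_bernstein P_def)
  next
    case False
    then show ?thesis by (auto simp: dual_bernstein_def)
  qed
  then show "degree (dual_bernstein n \<alpha> \<beta> j) \<le> n"
    and "i \<le> n \<Longrightarrow> wint (bernstein_poly n i * dual_bernstein n \<alpha> \<beta> j) = (if int i = j then 1 else 0)"
    by auto
qed

section \<open>Transposing the tridiagonal action\<close>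

lemma jacobi_op_dual_bernstein:
  assumes "i \<le> n"
  shows "jacobi_op (dual_bernstein n \<alpha> \<beta> (int i)) =
    smult ((real i - real n) * (real i + \<beta> + 1)) (dual_bernstein n \<alpha> \<beta> (int i + 1))
    + smult (real i * (real i - \<alpha> - real n - 1)) (dual_bernstein n \<alpha> \<beta> (int i - 1))
    - smult (real i * (real i - \<alpha> - real n - 1) + (real i - real n) * (real i + \<beta> + 1))
        (dual_bernstein n \<alpha> \<beta> (int i))" (is "_ = ?R")
proof -
  let ?D = "dual_bernstein n \<alpha> \<beta>" and ?b = "bernstein_poly n"
  have "jacobi_op (?D (int i)) - ?R = 0"
  proof (rule eq_0_if_orthogonal_bernstein_poly)
    show "degree (jacobi_op (?D (int i)) - ?R) \<le> n"
      by (intro degree_diff_le degree_add_le degree_jacobi_op_le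
          order.trans[OF degree_smult_le] degree_dual_bernstein_le)
  next
    fix k assume k: "k \<le> n"
    \<comment> \<open>At \<open>k = n\<close> the left side is 0 because B_{n+1} = 0, and the right
      side is 0 because \<open>i \<le> n\<close>.\<close>
    have Suc_k: "wint (?b (Suc k) * ?D (int i)) = (if Suc k = i then 1 else 0)"
      using k assms wint_dual_bernstein[of "Suc k" n "int i"]
      by (cases "k = n") (auto simp: bernstein_poly_eq_0)
    have pred_k: "wint (?b (k - 1) * ?D (int i)) = (if k - 1 = i then 1 else 0)"
      using k wint_dual_bernstein[of "k - 1" n "int i"] by auto
    have k_k: "wint (?b k * ?D (int i)) = (if k = i then 1 else 0)"
      using k wint_dual_bernstein[of k n "int i"] by auto
    have "wint (?b k * jacobi_op (?D (int i))) =
        (real k + 1) * (real k - \<alpha> - real n) * (if Suc k = i then 1 else 0)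
        + (if k = 0 then 0 else (real k - 1 - real n) * (real k + \<beta>) * (if k - 1 = i then 1 else 0))
        - (real k * (real k - \<alpha> - real n - 1) + (real k - real n) * (real k + \<beta> + 1))
          * (if k = i then 1 else 0)"
      unfolding jacobi_op_symmetric jacobi_op_bernstein_poly[OF k]
      by (simp only: left_diff_distrib distrib_right wint_diff wint_add mult_smult_left wint_smult
          Suc_k k_k pred_k if_distrib[of "\<lambda>p. p * _"] if_distrib[of wint] mult_zero_left wint_0)
    \<comment> \<open>Each coefficient depending on \<open>k\<close> is evaluated at the only
      \<open>k\<close> where its indicator is nonzero: \<open>i + 1\<close>, \<open>i - 1\<close>
      and \<open>i\<close>.\<close>
    also have "\<dots> = (real i - real n) * (real i + \<beta> + 1) * (if k = Suc i then 1 else 0)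
        + real i * (real i - \<alpha> - real n - 1) * (if Suc k = i then 1 else 0)
        - (real i * (real i - \<alpha> - real n - 1) + (real i - real n) * (real i + \<beta> + 1))
          * (if k = i then 1 else 0)"
    proof -
      consider "k = i" | "k = Suc i" | "i = Suc k" | "k \<noteq> i" "k \<noteq> Suc i" "i \<noteq> Suc k" by blast
      then show ?thesis
      proof cases
        case 1
        then have "k \<noteq> 0 \<Longrightarrow> k - 1 \<noteq> i" by linarith
        with 1 show ?thesis by simp
      next
        case 2
        then show ?thesis by (simp add: algebra_simps)
      next
        case 3
        then have "\<not> k - 1 = i" "k \<noteq> Suc i" "k \<noteq> i" by linarith+
        with 3 show ?thesis by (simp add: algebra_simps)
      next
        case 4
        then have "k \<noteq> 0 \<Longrightarrow> k - 1 \<noteq> i" by linarith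
        with 4 show ?thesis by simp
      qed
    qed
    also have "\<dots> = wint (?b k * ?R)"
    proof -
      have "int k = int i + 1 \<longleftrightarrow> k = Suc i" "int k = int i - 1 \<longleftrightarrow> Suc k = i" by auto
      then show ?thesis
        by (simp only: right_diff_distrib[of "?b k"] distrib_left[of "?b k"] wint_diff wint_add
            mult_smult_right wint_smult wint_dual_bernstein[OF k] of_nat_eq_iff)
    qed
    finally show "wint (?b k * (jacobi_op (?D (int i)) - ?R)) = 0"
      by (simp add: right_diff_distrib[of "?b k"] wint_diff)
  qed
  then show ?thesis by simp
qed

end

theorem theorem3p4:
  fixes \<alpha> \<beta> \<sigma> :: real and n i :: nat
  assumes "\<alpha> > -1" and "\<beta> > -1"
    and "\<sigma> = \<alpha> + \<beta> + 1"
    and "i \<le> n"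
  shows "[:0, 1:] * [:-1, 1:] * pderiv (pderiv (dual_bernstein n \<alpha> \<beta> (int i)))
       + smult (1 / 2) ([:\<alpha> - \<beta>:] + smult (\<sigma> + 1) [:-1, 2:]) * pderiv (dual_bernstein n \<alpha> \<beta> (int i))
       = smult ((real i - real n) * (real i + \<beta> + 1)) (dual_bernstein n \<alpha> \<beta> (int i + 1))
       + smult (real i * (real i - \<alpha> - real n - 1)) (dual_bernstein n \<alpha> \<beta> (int i - 1))
       - smult (real i * (real i - \<alpha> - real n - 1) + (real i - real n) * (real i + \<beta> + 1))
           (dual_bernstein n \<alpha> \<beta> (int i))"
proof -
  interpret jacobi_weight \<alpha> \<beta> using assms by unfold_locales
  \<comment> \<open>Since \<sigma> + 1 = \<alpha> + \<beta> + 2, the constant term is half of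
    \<alpha> - \<beta> - (\<alpha> + \<beta> + 2), that is -(\<beta> + 1).\<close>
  have "smult (1 / 2) ([:\<alpha> - \<beta>:] + smult (\<sigma> + 1) [:-1, 2:]) = [:- (\<beta> + 1), \<alpha> + \<beta> + 2:]"
    by (simp add: assms(3) field_simps)
  then show ?thesis
    using jacobi_op_dual_bernstein[OF assms(4)] by (simp only: jacobi_op_def)
qed

end
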